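(* Let $n\ge 1$ and $p\geq 2$ be integers, and let $G_{1},\ldots,G_{p}\subset\binom{[n]}{2}$ be 2-colored triangle free. Then \[ \sum_{i=1}^{p}e(G_i)\leq p \cdot \left\lfloor\frac{n^{2}}{4}\right\rfloor . \] Moreover, equality holds if and only if $G_{1}=\cdots=G_{p}=K_{\lfloor \frac{n}{2}\rfloor, \lceil \frac{n}{2}\rceil}$, i.e. all $G_i$ are the same graph on $[n]$ and this graph is a complete bipartite graph with parts of sizes $\lfloor n/2\rfloor$ and $\lceil n/2\rceil$.
   Context: $[n]=\{1,\ldots,n\}$. Each $G_i\subset\binom{[n]}{2}$ is regarded as (the edge set of) a simple graph on the vertex set $[n]$, and $e(G_i)$ is its number of edges. The edge-colored multiple graph $G_1+\cdots+G_p$ is the multigraph on $[n]$ in which the edges of $G_i$ have color $i$ (so a pair may carry several colors). An edge-colored triangle is 2-colored if two of its edges have the same color and the third edge has a different color. The graphs $G_1,\ldots,G_p$ are 2-colored triangle free if $G_1+\cdots+G_p$ contains no 2-colored triangle; that is, there are no distinct vertices $x,y,z\in[n]$ and indices $i\neq j$ with $xy,xz\in E(G_i)$ and $yz\in E(G_j)$. *)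

theory Defs
  imports Complex_Main "HOL-Library.Ramsey"
begin

text \<open>A simple graph on \<open>V\<close> is given by its edge set, a subset of \<open>[V]\<^bsup>2\<^esup>\<close>
  (the two-element subsets of \<open>V\<close>, from \<^theory>\<open>HOL-Library.Ramsey\<close>).\<close>

text \<open>No triangle of the coloured multigraph has two edges of one colour \<open>i\<close> and the third
  of another colour \<open>j\<close>. Triangles contained in
  a single \<open>G i\<close> are allowed.\<close>

definition two_colored_triangle_free :: "'a set \<Rightarrow> 'i set \<Rightarrow> ('i \<Rightarrow> 'a set set) \<Rightarrow> bool" where
  "two_colored_triangle_free V I G \<longleftrightarrow>
     \<not> (\<exists>x\<in>V. \<exists>y\<in>V. \<exists>z\<in>V. \<exists>i\<in>I. \<exists>j\<in>I.
          x \<noteq> y \<and> x \<noteq> z \<and> y \<noteq> z \<and> i \<noteq> j \<and>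
          {x, y} \<in> G i \<and> {x, z} \<in> G i \<and> {y, z} \<in> G j)"

text \<open>The labelled graph \<open>E\<close> on vertex set \<open>V\<close> is a copy of \<open>K\<^bsub>a,b\<^esub>\<close> with \<open>V\<close> as
  its vertex set; empty parts are allowed.\<close>

definition is_complete_bipartite :: "'a set \<Rightarrow> nat \<Rightarrow> nat \<Rightarrow> 'a set set \<Rightarrow> bool" where
  "is_complete_bipartite V a b E \<longleftrightarrow>
     (\<exists>A B. finite A \<and> finite B \<and> A \<union> B = V \<and> A \<inter> B = {} \<and> card A = a \<and> card B = b \<and>
            E = {{x, y} | x y. x \<in> A \<and> y \<in> B})"

end

theory Submission
  imports Defs
begin

text \<open>Give every pair of vertices as weight the number of colours it carries, so that the
  left-hand side is the total weight. The argument is Mantel's induction, which removes the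
  two ends of an edge, carried out for these weights; without a pair of positive weight
  there is nothing to bound. Let \<open>x y\<close> be a pair of positive weight, let \<open>z\<close> be a third
  vertex and let there be \<open>p \<ge> 2\<close> colours. Then \<open>x z\<close> and \<open>y z\<close> have total weight at most
  \<open>p\<close>: this is clear if their colours are disjoint, and if they share a colour \<open>i\<close>, then the
  triangle \<open>x y z\<close> carries no colour but \<open>i\<close>, and the total is \<open>2\<close>
  (\<open>card_colours_two_sides_le\<close>). Hence, on \<open>n\<close> vertices, the pairs meeting \<open>{x, y}\<close> have
  total weight at most \<open>p + p * (n - 2)\<close>, which is exactly \<open>p\<close> times the difference between
  the values of \<open>n\<^sup>2 div 4\<close> at \<open>n\<close> and at \<open>n - 2\<close> (\<open>sum_card_le_mantel\<close>).

  If equality holds, then every estimate is sharp, and this for every pair of positive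
  weight in the role of \<open>x y\<close> (\<open>extremal_sharp\<close>). So each such pair has weight \<open>p\<close>, which
  means that all colour classes are one and the same graph \<open>E\<close>, which is triangle free
  because \<open>p \<ge> 2\<close>. Moreover, for an edge \<open>x y\<close> of \<open>E\<close>, every other vertex is adjacent to \<open>x\<close>
  or to \<open>y\<close>. Hence the vertices that are not neighbours of \<open>x\<close> are neighbours of \<open>y\<close>, and as
  the neighbours of one vertex are pairwise non-adjacent, they and the neighbours of \<open>x\<close>
  form a bipartition of \<open>E\<close>. Since \<open>E\<close> has \<open>n\<^sup>2 div 4\<close> edges, the maximum possible for a
  bipartite graph, it is complete bipartite with balanced parts (\<open>extremal_bipartite\<close>).\<close>

section \<open>Arithmetic of the Mantel bound\<close>

lemma add_2_square_div_4: "((k::nat) + 2)\<^sup>2 div 4 = k + 1 + k\<^sup>2 div 4"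
proof -
  have "(k + 2)\<^sup>2 = 4 * (k + 1) + k\<^sup>2"
    by (simp add: power2_eq_square algebra_simps)
  then show ?thesis by simp
qed

text \<open>For parts that differ by \<open>d\<close>, the identity \<open>(2 a + d)\<^sup>2 = 4 a (a + d) + d\<^sup>2\<close> shows that the
  product falls short of the bound by exactly \<open>d\<^sup>2 div 4\<close>, which vanishes only for \<open>d < 2\<close>.\<close>

lemma square_sum_div_4: "((a::nat) + (a + d))\<^sup>2 div 4 = a * (a + d) + d\<^sup>2 div 4"
proof -
  have "(a + (a + d))\<^sup>2 = 4 * (a * (a + d)) + d\<^sup>2"
    by (simp add: power2_eq_square algebra_simps)
  then show ?thesis by simp
qed

lemma mult_le_square_sum_div_4: "(a::nat) * b \<le> (a + b)\<^sup>2 div 4"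
proof (cases "a \<le> b")
  case True
  then obtain d where "b = a + d" using le_Suc_ex by blast
  then show ?thesis using square_sum_div_4[of a d] by simp
next
  case False
  then obtain d where "a = b + d" using le_Suc_ex nat_le_linear by blast
  then show ?thesis using square_sum_div_4[of b d] by (simp add: ac_simps)
qed

lemma balanced_if_mult_eq_square_sum_div_4:
  fixes a b :: nat
  assumes "a * b = (a + b)\<^sup>2 div 4" and "a \<le> b"
  shows "a = (a + b) div 2 \<and> b = (a + b + 1) div 2"
proof -
  obtain d where d: "b = a + d" using assms(2) le_Suc_ex by blast
  have "d\<^sup>2 div 4 = 0" using assms(1) square_sum_div_4[of a d] d by simp
  then have "d\<^sup>2 < 2\<^sup>2" by (simp add: div_eq_0_iff)
  then have "d < 2" by (rule power_less_imp_less_base) simp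
  then show ?thesis using d by presburger
qed

lemma half_mult_half: "((n::nat) div 2) * ((n + 1) div 2) = n\<^sup>2 div 4"
proof -
  obtain a d where n: "n = a + (a + d)" and d: "d < 2"
    using mult_div_mod_eq[of 2 n] mod_less_divisor[of 2 n] by (metis add.assoc mult_2 zero_less_numeral)
  have "n div 2 = a" "(n + 1) div 2 = a + d" using n d by presburger+
  moreover have "d\<^sup>2 div 4 = 0" using d by (cases d) auto
  ultimately show ?thesis using square_sum_div_4[of a d] n by simp
qed

section \<open>Colours on the sides of a triangle\<close>

definition colours :: "'i set \<Rightarrow> ('i \<Rightarrow> 'a set set) \<Rightarrow> 'a set \<Rightarrow> 'i set" where
  "colours I G e = {i \<in> I. e \<in> G i}"

lemma finite_colours: "finite I \<Longrightarrow> finite (colours I G e)"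
  by (simp add: colours_def)

lemma card_colours_le: "finite I \<Longrightarrow> card (colours I G e) \<le> card I"
  by (auto simp: colours_def intro: card_mono)

lemma sum_of_bool_colours:
  "finite I \<Longrightarrow> (\<Sum>i\<in>I. of_bool (e \<in> G i)) = card (colours I G e)"
  by (simp add: colours_def Int_def)

lemma two_colored_triangle_freeD:
  assumes "two_colored_triangle_free V I G"
    and "x \<in> V" "y \<in> V" "z \<in> V" "x \<noteq> y" "x \<noteq> z" "y \<noteq> z"
    and "i \<in> I" "j \<in> I" "{x, y} \<in> G i" "{x, z} \<in> G i" "{y, z} \<in> G j"
  shows "i = j"
  using assms unfolding two_colored_triangle_free_def by metis

lemma third_side_colours:
  assumes "two_colored_triangle_free V I G"
    and "x \<in> V" "y \<in> V" "z \<in> V" "x \<noteq> y" "x \<noteq> z" "y \<noteq> z"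
    and "i \<in> colours I G {x, y}" "i \<in> colours I G {x, z}"
  shows "colours I G {y, z} \<subseteq> {i}"
  using assms(8,9) two_colored_triangle_freeD[OF assms(1-7)] by (auto simp: colours_def)

text \<open>If the sides \<open>x z\<close> and \<open>y z\<close> share a colour \<open>i\<close>, it is the only colour of \<open>x y\<close>. As
  \<open>x y\<close> is coloured, \<open>i\<close> then lies on all three sides, so each side has only this colour.\<close>

lemma card_colours_two_sides_le:
  assumes free: "two_colored_triangle_free V I G" and I: "finite I" "card I \<ge> 2"
    and xyz: "x \<in> V" "y \<in> V" "z \<in> V" "x \<noteq> y" "x \<noteq> z" "y \<noteq> z"
    and xy: "colours I G {x, y} \<noteq> {}"
  shows "card (colours I G {x, z}) + card (colours I G {y, z}) \<le> card I"
proof (cases "colours I G {x, z} \<inter> colours I G {y, z} = {}")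
  case True
  then have "card (colours I G {x, z}) + card (colours I G {y, z})
      = card (colours I G {x, z} \<union> colours I G {y, z})"
    using I by (simp add: card_Un_disjoint finite_colours)
  also have "\<dots> \<le> card I"
    using I by (intro card_mono) (auto simp: colours_def)
  finally show ?thesis .
next
  case False
  then obtain i where i: "i \<in> colours I G {x, z}" "i \<in> colours I G {y, z}" by blast
  have "i \<in> colours I G {x, y}"
    using third_side_colours[OF free, of z x y i] i xy xyz by (auto simp: insert_commute)
  then have "colours I G {y, z} \<subseteq> {i}" "colours I G {x, z} \<subseteq> {i}"
    using third_side_colours[OF free, of x y z i] third_side_colours[OF free, of y x z i] i xyz
    by (auto simp: insert_commute)
  then have "card (colours I G {y, z}) \<le> 1" "card (colours I G {x, z}) \<le> 1"
    using card_mono[of "{i}"] by fastforce+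
  then show ?thesis using I by linarith
qed

section \<open>Removing the two ends of an edge\<close>

lemma card_edges_remove_two:
  assumes V: "finite V" and xy: "x \<in> V" "y \<in> V" "x \<noteq> y" and E: "E \<subseteq> [V]\<^bsup>2\<^esup>"
  shows "card E = of_bool ({x, y} \<in> E)
      + (\<Sum>z\<in>V - {x, y}. of_bool ({x, z} \<in> E) + of_bool ({y, z} \<in> E))
      + card {e \<in> E. x \<notin> e \<and> y \<notin> e}"
proof -
  define W where "W = V - {x, y}"
  define S where "S u = (\<lambda>z. {u, z}) ` {z \<in> W. {u, z} \<in> E}" for u
  have fW: "finite W" using V by (simp add: W_def)
  have fE: "finite E" using E V finite_subset finite_imp_finite_nsets by blast
  have card_S: "card (S u) = (\<Sum>z\<in>W. of_bool ({u, z} \<in> E))" for u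
  proof -
    have "card (S u) = card {z \<in> W. {u, z} \<in> E}"
      unfolding S_def by (rule card_image) (auto simp: inj_on_def doubleton_eq_iff)
    then show ?thesis using fW by (simp add: Int_def)
  qed
  have fS: "finite (S u)" for u using fW by (simp add: S_def)
  have split: "E = (E \<inter> {{x, y}}) \<union> (S x \<union> S y) \<union> {e \<in> E. x \<notin> e \<and> y \<notin> e}" (is "E = ?R")
  proof
    show "E \<subseteq> ?R"
    proof
      fix e assume e: "e \<in> E"
      then have "e \<in> [V]\<^bsup>2\<^esup>" using E by blast
      then obtain u v where uv: "e = {u, v}" "u \<in> V" "v \<in> V" "u \<noteq> v"
        by (rule nsets2_E)
      show "e \<in> ?R"
        using e uv unfolding S_def W_def by (auto simp: insert_commute)
    qed
    show "?R \<subseteq> E" unfolding S_def by auto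
  qed
  have disjoint: "S x \<inter> S y = {}" "(E \<inter> {{x, y}}) \<inter> (S x \<union> S y) = {}"
      "(E \<inter> {{x, y}} \<union> (S x \<union> S y)) \<inter> {e \<in> E. x \<notin> e \<and> y \<notin> e} = {}"
    using xy by (auto simp: S_def W_def doubleton_eq_iff)
  have "card E = card (E \<inter> {{x, y}}) + (card (S x) + card (S y))
      + card {e \<in> E. x \<notin> e \<and> y \<notin> e}"
    using arg_cong[OF split, of card] fE fS disjoint by (simp add: card_Un_disjoint)
  moreover have "card (E \<inter> {{x, y}}) = of_bool ({x, y} \<in> E)" by auto
  ultimately show ?thesis by (simp add: card_S sum.distrib W_def)
qed

lemma sum_card_remove_two:
  assumes "finite V" "x \<in> V" "y \<in> V" "x \<noteq> y" and I: "finite I"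
    and "\<And>i. i \<in> I \<Longrightarrow> G i \<subseteq> [V]\<^bsup>2\<^esup>"
  shows "(\<Sum>i\<in>I. card (G i)) = card (colours I G {x, y})
      + (\<Sum>z\<in>V - {x, y}. card (colours I G {x, z}) + card (colours I G {y, z}))
      + (\<Sum>i\<in>I. card {e \<in> G i. x \<notin> e \<and> y \<notin> e})"
proof -
  have "(\<Sum>i\<in>I. card (G i)) = (\<Sum>i\<in>I. of_bool ({x, y} \<in> G i)
      + (\<Sum>z\<in>V - {x, y}. of_bool ({x, z} \<in> G i) + of_bool ({y, z} \<in> G i))
      + card {e \<in> G i. x \<notin> e \<and> y \<notin> e})"
    using assms by (intro sum.cong card_edges_remove_two) auto
  also have "\<dots> = (\<Sum>i\<in>I. of_bool ({x, y} \<in> G i))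
      + (\<Sum>z\<in>V - {x, y}. \<Sum>i\<in>I. of_bool ({x, z} \<in> G i) + of_bool ({y, z} \<in> G i))
      + (\<Sum>i\<in>I. card {e \<in> G i. x \<notin> e \<and> y \<notin> e})"
    by (simp only: sum.distrib sum.swap[of _ "V - {x, y}" I])
  finally show ?thesis
    using sum_of_bool_colours[OF I, where G = G] by (simp add: sum.distrib)
qed

lemma two_colored_triangle_free_remove:
  assumes "two_colored_triangle_free V I G"
  shows "two_colored_triangle_free (V - X) I (\<lambda>i. {e \<in> G i. P e})"
  unfolding two_colored_triangle_free_def
proof (rule notI, elim bexE conjE)
  fix x y z i j
  assume "x \<in> V - X" "y \<in> V - X" "z \<in> V - X" "i \<in> I" "j \<in> I" "x \<noteq> y" "x \<noteq> z" "y \<noteq> z" "i \<noteq> j"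
    and "{x, y} \<in> {e \<in> G i. P e}" "{x, z} \<in> {e \<in> G i. P e}" "{y, z} \<in> {e \<in> G j. P e}"
  then show False
    using two_colored_triangle_freeD[OF assms, of x y z i j] by simp
qed

theorem sum_card_le_mantel:
  assumes "finite V" and I: "finite I" "card I \<ge> 2"
    and "\<And>i. i \<in> I \<Longrightarrow> G i \<subseteq> [V]\<^bsup>2\<^esup>" and "two_colored_triangle_free V I G"
  shows "(\<Sum>i\<in>I. card (G i)) \<le> card I * ((card V)\<^sup>2 div 4)"
  using assms(1,4,5)
proof (induction V arbitrary: G rule: finite_psubset_induct)
  case (psubset V)
  note G = psubset.prems(1) and free = psubset.prems(2)
  show ?case
  proof (cases "\<exists>i\<in>I. G i \<noteq> {}")
    case False
    then show ?thesis by simp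
  next
    case True
    then obtain i e where e: "i \<in> I" "e \<in> G i" by blast
    then have "e \<in> [V]\<^bsup>2\<^esup>" using G by blast
    then obtain x y where "e = {x, y}" and xy: "x \<in> V" "y \<in> V" "x \<noteq> y"
      by (rule nsets2_E)
    with e have coloured: "colours I G {x, y} \<noteq> {}"
      by (auto simp: colours_def)
    define W where "W = V - {x, y}"
    define H where "H i = {e \<in> G i. x \<notin> e \<and> y \<notin> e}" for i
    have card_V: "card V = card W + 2"
      using xy psubset.hyps card_Diff_subset[of "{x, y}" V] card_mono[of V "{x, y}"]
      by (simp add: W_def)
    have "(\<Sum>i\<in>I. card (H i)) \<le> card I * ((card W)\<^sup>2 div 4)"
    proof (rule psubset.IH)
      show "W \<subset> V" using xy by (auto simp: W_def)
      show "H i \<subseteq> [W]\<^bsup>2\<^esup>" if "i \<in> I" for i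
        using G[OF that] by (auto simp: H_def W_def nsets_def)
      show "two_colored_triangle_free W I H"
        unfolding W_def H_def by (rule two_colored_triangle_free_remove[OF free])
    qed
    moreover have "(\<Sum>z\<in>W. card (colours I G {x, z}) + card (colours I G {y, z}))
        \<le> of_nat (card W) * card I"
      using card_colours_two_sides_le[OF free I] xy coloured
      by (intro sum_bounded_above) (auto simp: W_def)
    moreover have "card (colours I G {x, y}) \<le> card I" using I by (rule_tac card_colours_le)
    moreover have "(\<Sum>i\<in>I. card (G i)) = card (colours I G {x, y})
        + (\<Sum>z\<in>W. card (colours I G {x, z}) + card (colours I G {y, z}))
        + (\<Sum>i\<in>I. card (H i))"
      unfolding W_def H_def using psubset.hyps xy I(1) G by (rule sum_card_remove_two)
    ultimately have "(\<Sum>i\<in>I. card (G i))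
        \<le> card I + card W * card I + card I * ((card W)\<^sup>2 div 4)"
      by simp
    also have "\<dots> = card I * ((card V)\<^sup>2 div 4)"
      unfolding card_V add_2_square_div_4 by (simp add: algebra_simps)
    finally show ?thesis .
  qed
qed

section \<open>The extremal configurations\<close>

text \<open>In the case of equality every estimate of the induction step is sharp, and any coloured
  pair may be the one that is removed.\<close>

lemma extremal_sharp:
  assumes V: "finite V" and I: "finite I" "card I \<ge> 2"
    and G: "\<And>i. i \<in> I \<Longrightarrow> G i \<subseteq> [V]\<^bsup>2\<^esup>" and free: "two_colored_triangle_free V I G"
    and eq: "(\<Sum>i\<in>I. card (G i)) = card I * ((card V)\<^sup>2 div 4)"
    and xy: "x \<in> V" "y \<in> V" "x \<noteq> y" "colours I G {x, y} \<noteq> {}"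
  shows "colours I G {x, y} = I"
    and "\<And>z. z \<in> V - {x, y} \<Longrightarrow> colours I G {x, z} \<noteq> {} \<or> colours I G {y, z} \<noteq> {}"
proof -
  define W where "W = V - {x, y}"
  define H where "H i = {e \<in> G i. x \<notin> e \<and> y \<notin> e}" for i
  define f where "f z = card (colours I G {x, z}) + card (colours I G {y, z})" for z
  have card_V: "card V = card W + 2"
    using xy V card_Diff_subset[of "{x, y}" V] card_mono[of V "{x, y}"] by (simp add: W_def)
  have H: "(\<Sum>i\<in>I. card (H i)) \<le> card I * ((card W)\<^sup>2 div 4)"
  proof (rule sum_card_le_mantel[OF _ I])
    show "finite W" using V by (simp add: W_def)
    show "H i \<subseteq> [W]\<^bsup>2\<^esup>" if "i \<in> I" for i
      using G[OF that] by (auto simp: H_def W_def nsets_def)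
    show "two_colored_triangle_free W I H"
      unfolding W_def H_def by (rule two_colored_triangle_free_remove[OF free])
  qed
  have f_le: "f z \<le> card I" if "z \<in> W" for z
    using card_colours_two_sides_le[OF free I] xy that by (auto simp: W_def f_def)
  have f_sum: "(\<Sum>z\<in>W. f z) \<le> (\<Sum>z\<in>W. card I)"
    using f_le by (rule sum_mono)
  have xy_le: "card (colours I G {x, y}) \<le> card I" using I by (rule_tac card_colours_le)
  have "(\<Sum>i\<in>I. card (G i))
      = card (colours I G {x, y}) + (\<Sum>z\<in>W. f z) + (\<Sum>i\<in>I. card (H i))"
    unfolding W_def H_def f_def using V xy(1-3) I(1) G by (rule sum_card_remove_two)
  then have "card (colours I G {x, y}) + (\<Sum>z\<in>W. f z) + (\<Sum>i\<in>I. card (H i))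
      = card I * ((card V)\<^sup>2 div 4)"
    using eq by simp
  also have "\<dots> = card I + (\<Sum>z\<in>W. card I) + card I * ((card W)\<^sup>2 div 4)"
    unfolding card_V add_2_square_div_4 by (simp add: algebra_simps)
  finally have sharp: "card (colours I G {x, y}) = card I" "(\<Sum>z\<in>W. f z) = (\<Sum>z\<in>W. card I)"
    using H f_sum xy_le by linarith+
  show "colours I G {x, y} = I"
    using sharp(1) I by (intro card_subset_eq) (auto simp: colours_def)
  show "colours I G {x, z} \<noteq> {} \<or> colours I G {y, z} \<noteq> {}" if "z \<in> V - {x, y}" for z
  proof -
    have "f z = card I"
      using sum_mono_inv[OF sharp(2) f_le] that V by (simp add: W_def)
    then show ?thesis using I(2) by (auto simp: f_def)
  qed
qed

lemma card_complete_bipartite: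
  assumes "is_complete_bipartite V a b E"
  shows "card E = a * b"
proof -
  obtain A B where AB: "finite A" "finite B" "A \<inter> B = {}" "card A = a" "card B = b"
      "E = {{x, y} | x y. x \<in> A \<and> y \<in> B}"
    using assms unfolding is_complete_bipartite_def by blast
  have "E = (\<lambda>(x, y). {x, y}) ` (A \<times> B)" using AB(6) by auto
  moreover have "inj_on (\<lambda>(x, y). {x, y}) (A \<times> B)"
    using AB(3) by (auto simp: inj_on_def doubleton_eq_iff)
  ultimately show ?thesis using AB by (simp add: card_image card_cartesian_product)
qed

lemma is_complete_bipartite_commute:
  assumes "is_complete_bipartite V a b E"
  shows "is_complete_bipartite V b a E"
proof -
  obtain A B where AB: "finite A" "finite B" "A \<union> B = V" "A \<inter> B = {}" "card A = a" "card B = b"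
      "E = {{x, y} | x y. x \<in> A \<and> y \<in> B}"
    using assms unfolding is_complete_bipartite_def by blast
  have "{x, y} = {y, x}" for x y :: 'a by (rule insert_commute)
  then have "E = {{x, y} | x y. x \<in> B \<and> y \<in> A}"
    unfolding AB(7) by blast
  then show ?thesis
    unfolding is_complete_bipartite_def using AB(1-6)
    by (intro exI[of _ B] exI[of _ A]) (simp add: Un_commute Int_commute)
qed

text \<open>A bipartite graph is contained in the complete bipartite graph on its parts, which has at
  most \<open>n\<^sup>2 div 4\<close> edges, with equality only for balanced parts.\<close>

lemma extremal_bipartite:
  assumes "finite A" "finite B" "A \<inter> B = {}" "A \<union> B = V"
    and sub: "E \<subseteq> {{x, y} | x y. x \<in> A \<and> y \<in> B}" and E: "card E = (card V)\<^sup>2 div 4"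
  shows "is_complete_bipartite V (card V div 2) ((card V + 1) div 2) E"
proof -
  define K where "K = {{x, y} | x y. x \<in> A \<and> y \<in> B}"
  have K: "is_complete_bipartite V (card A) (card B) K"
    unfolding is_complete_bipartite_def K_def using assms by blast
  have card_K: "card K = card A * card B" by (rule card_complete_bipartite[OF K])
  have "K \<subseteq> Pow V" using assms(4) by (auto simp: K_def)
  then have fK: "finite K" using assms(1,2,4) by (metis finite_Pow_iff finite_Un finite_subset)
  have card_V: "card V = card A + card B" using assms card_Un_disjoint by blast
  have EK: "E = K"
    using sub fK E card_K mult_le_square_sum_div_4[of "card A" "card B"] card_V
    unfolding K_def[symmetric] by (metis card_seteq)
  then have prod: "card A * card B = (card A + card B)\<^sup>2 div 4" using E card_K card_V by simp
  show ?thesis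
  proof (cases "card A \<le> card B")
    case True
    show ?thesis
      using balanced_if_mult_eq_square_sum_div_4[OF prod True] K EK card_V by simp
  next
    case False
    have "card B = card V div 2 \<and> card A = (card V + 1) div 2"
      using balanced_if_mult_eq_square_sum_div_4[of "card B" "card A"] prod False card_V
      by (simp add: ac_simps)
    then show ?thesis using is_complete_bipartite_commute[OF K] EK by simp
  qed
qed

theorem extremal_complete_bipartite:
  assumes V: "finite V" and I: "finite I" "card I \<ge> 2"
    and G: "\<And>i. i \<in> I \<Longrightarrow> G i \<subseteq> [V]\<^bsup>2\<^esup>" and free: "two_colored_triangle_free V I G"
    and eq: "(\<Sum>i\<in>I. card (G i)) = card I * ((card V)\<^sup>2 div 4)"
  shows "\<exists>E. is_complete_bipartite V (card V div 2) ((card V + 1) div 2) E \<and> (\<forall>i\<in>I. G i = E)"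
proof -
  note sharp = extremal_sharp[OF V I G free eq]
  obtain k where k: "k \<in> I" using I(2) by fastforce
  obtain l where l: "l \<in> I" "l \<noteq> k"
    using I k by (metis card_le_Suc0_iff_eq not_less_eq_eq numeral_2_eq_2)
  define E where "E = G k"
  have E_sub: "E \<subseteq> [V]\<^bsup>2\<^esup>" using G k by (simp add: E_def)
  have edge: "\<exists>x y. e = {x, y} \<and> x \<in> V \<and> y \<in> V \<and> x \<noteq> y" if "e \<in> G i" "i \<in> I" for e i
  proof -
    have "e \<in> [V]\<^bsup>2\<^esup>" using G that by blast
    then show ?thesis by (rule nsets2_E) blast
  qed
  have all_colours: "e \<in> G j" if "e \<in> G i" "i \<in> I" "j \<in> I" for e i j
  proof -
    obtain x y where xy: "e = {x, y}" "x \<in> V" "y \<in> V" "x \<noteq> y"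
      using edge \<open>e \<in> G i\<close> \<open>i \<in> I\<close> by blast
    then have "colours I G {x, y} = I" using that by (intro sharp) (auto simp: colours_def)
    then show ?thesis using xy that by (auto simp: colours_def)
  qed
  then have GE: "\<forall>i\<in>I. G i = E" using k by (auto simp: E_def)
  have triangle_free: False
    if "{x, y} \<in> E" "{x, z} \<in> E" "{y, z} \<in> E" "x \<in> V" "y \<in> V" "z \<in> V"
      "x \<noteq> y" "x \<noteq> z" "y \<noteq> z" for x y z
    using two_colored_triangle_freeD[OF free, of x y z k l] that k l GE by simp
  have card_E: "card E = (card V)\<^sup>2 div 4"
    using eq GE I(2) by simp
  have "is_complete_bipartite V (card V div 2) ((card V + 1) div 2) E"
  proof (cases "E = {}")
    case True
    \<comment> \<open>Then \<open>V\<close> has at most one vertex, so any bipartition will do.\<close>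
    show ?thesis
      using V True card_E by (intro extremal_bipartite[of "{}" V]) auto
  next
    case False
    then obtain x y where xy: "{x, y} \<in> E" "x \<in> V" "y \<in> V" "x \<noteq> y"
      using edge k unfolding E_def by blast
    have no_loop: "u \<noteq> v" if "{u, v} \<in> E" for u v
      using E_sub that by (auto simp: nsets_def)
    define A where "A = {v \<in> V. {x, v} \<in> E}"
    have y_adj: "{y, v} \<in> E" if v: "v \<in> V - A" for v
    proof (cases "v = x")
      case True
      then show ?thesis using xy by (simp add: insert_commute)
    next
      case False
      moreover have "v \<noteq> y" using v xy by (auto simp: A_def)
      moreover have "colours I G {x, y} \<noteq> {}" using xy(1) k by (auto simp: E_def colours_def)
      ultimately have "colours I G {x, v} \<noteq> {} \<or> colours I G {y, v} \<noteq> {}"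
        using xy v by (intro sharp(2)) auto
      then show ?thesis using v GE by (auto simp: colours_def A_def)
    qed
    have "E \<subseteq> {{a, b} | a b. a \<in> A \<and> b \<in> V - A}"
    proof
      fix e assume e: "e \<in> E"
      then obtain u v where uv: "e = {u, v}" "u \<in> V" "v \<in> V" "u \<noteq> v"
        using edge k unfolding E_def by blast
      have "\<not> (u \<in> A \<and> v \<in> A)"
        using triangle_free[of x u v] e uv xy no_loop[of x u] no_loop[of x v]
        by (auto simp: A_def)
      moreover have "\<not> (u \<notin> A \<and> v \<notin> A)"
        using triangle_free[of y u v] e uv xy y_adj[of u] y_adj[of v]
          no_loop[of y u] no_loop[of y v]
        by auto
      ultimately show "e \<in> {{a, b} | a b. a \<in> A \<and> b \<in> V - A}"
        using uv by (auto simp: insert_commute)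
    qed
    then show ?thesis
      using V card_E by (intro extremal_bipartite[of A "V - A"]) (auto simp: A_def)
  qed
  then show ?thesis using GE by blast
qed

section \<open>The theorem for the vertex set [n]\<close>

theorem theorem1p8:
  fixes n p :: nat and G :: "nat \<Rightarrow> nat set set"
  assumes "n \<ge> 1" and "p \<ge> 2"
    and "\<And>i. i \<in> {1..p} \<Longrightarrow> G i \<subseteq> [{1..n}]\<^bsup>2\<^esup>"
    and "two_colored_triangle_free {1..n} {1..p} G"
  shows "(\<Sum>i=1..p. int (card (G i))) \<le> int p * \<lfloor>(real n)\<^sup>2 / 4\<rfloor> \<and>
         ((\<Sum>i=1..p. int (card (G i))) = int p * \<lfloor>(real n)\<^sup>2 / 4\<rfloor> \<longleftrightarrow>
          (\<exists>E. is_complete_bipartite {1..n} (nat \<lfloor>real n / 2\<rfloor>) (nat \<lceil>real n / 2\<rceil>) E \<and>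
               (\<forall>i\<in>{1..p}. G i = E)))"
proof -
  have floor_square: "\<lfloor>(real n)\<^sup>2 / 4\<rfloor> = int (n\<^sup>2 div 4)"
    using floor_divide_of_nat_eq[of "n\<^sup>2" 4, where 'a = real] by simp
  have floor_half: "nat \<lfloor>real n / 2\<rfloor> = n div 2"
    using floor_divide_of_nat_eq[of n 2, where 'a = real] by simp
  have ceiling_half: "nat \<lceil>real n / 2\<rceil> = (n + 1) div 2"
    by linarith
  have sum_int: "(\<Sum>i=1..p. int (card (G i))) = int (\<Sum>i=1..p. card (G i))" by simp
  have bound: "(\<Sum>i=1..p. card (G i)) \<le> p * (n\<^sup>2 div 4)"
    using sum_card_le_mantel[of "{1..n}" "{1..p}" G] assms by simp
  have "(\<Sum>i=1..p. card (G i)) = p * (n\<^sup>2 div 4) \<longleftrightarrow>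
      (\<exists>E. is_complete_bipartite {1..n} (n div 2) ((n + 1) div 2) E \<and> (\<forall>i\<in>{1..p}. G i = E))"
    (is "?eq \<longleftrightarrow> ?bip")
  proof
    assume ?eq
    then show ?bip
      using extremal_complete_bipartite[of "{1..n}" "{1..p}" G] assms by simp
  next
    assume ?bip
    then obtain E where E: "is_complete_bipartite {1..n} (n div 2) ((n + 1) div 2) E"
        "\<forall>i\<in>{1..p}. G i = E" by blast
    then show ?eq using card_complete_bipartite[OF E(1)] half_mult_half[of n] by simp
  qed
  then show ?thesis
    unfolding floor_square floor_half ceiling_half sum_int of_nat_mult[symmetric]
      of_nat_eq_iff of_nat_le_iff
    using bound by blast
qed

end
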